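(* Let $G$ be a group with neutral element $e$ and let $\mathcal{R} = \bigoplus_{g\in G} \mathcal{R}_g$ be a strongly $G$-graded ring. If $\mathcal{R}_e$ is maximal commutative in $\mathcal{R}$, then the following two assertions are equivalent: (i) $\mathcal{R}_e$ is a $G$-simple ring (with respect to the canonical action). (ii) $\mathcal{R}$ is a simple ring.
   Context: All rings are associative and unital; $G$ is an arbitrary group. A ring $\mathcal{R}$ is $G$-graded if $\mathcal{R}=\bigoplus_{g\in G}\mathcal{R}_g$ for additive subgroups $\mathcal{R}_g$ with $\mathcal{R}_g\mathcal{R}_h\subseteq \mathcal{R}_{gh}$ for all $g,h\in G$; it is strongly $G$-graded if moreover $\mathcal{R}_g\mathcal{R}_h=\mathcal{R}_{gh}$ for all $g,h\in G$, where $\mathcal{R}_g\mathcal{R}_h$ is the set of all finite sums of products $r_gr_h$ with $r_g\in\mathcal{R}_g$, $r_h\in\mathcal{R}_h$. For a subset $S\subseteq \mathcal{R}$, the commutant $C_{\mathcal{R}}(S)$ is the set of elements of $\mathcal{R}$ commuting with every element of $S$. A commutative subring $S$ of $\mathcal{R}$ is maximal commutative in $\mathcal{R}$ if $C_{\mathcal{R}}(S)=S$. Canonical action: in a strongly $G$-graded ring, $1_{\mathcal{R}}\in\mathcal{R}_e=\mathcal{R}_g\mathcal{R}_{g^{-1}}$, so for each $g\in G$ one can write $1_{\mathcal{R}}=\sum_{i=1}^{n_g}a_g^{(i)}b_{g^{-1}}^{(i)}$ with $a_g^{(i)}\in\mathcal{R}_g$, $b_{g^{-1}}^{(i)}\in\mathcal{R}_{g^{-1}}$.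 For $\lambda\in C_{\mathcal{R}}(\mathcal{R}_e)$ put $\sigma_g(\lambda)=\sum_{i=1}^{n_g}a_g^{(i)}\,\lambda\,b_{g^{-1}}^{(i)}$. This is independent of the choices, and $g\mapsto\sigma_g$ is an action of $G$ by ring automorphisms on $C_{\mathcal{R}}(\mathcal{R}_e)$, restricting to an action by ring automorphisms on the center $Z(\mathcal{R}_e)$; it is called the canonical action. When $\mathcal{R}_e$ is maximal commutative, $\mathcal{R}_e=Z(\mathcal{R}_e)=C_{\mathcal{R}}(\mathcal{R}_e)$, so $G$ acts on $\mathcal{R}_e$. Ideals are two-sided. A ring is simple if it has no ideals other than $\{0\}$ and itself. For a ring $A$ with an action $\sigma:G\to\mathrm{Aut}(A)$, an ideal $I$ of $A$ is $G$-invariant if $\sigma_g(I)\subseteq I$ for each $g\in G$; $A$ is $G$-simple if it has no $G$-invariant ideals other than $\{0\}$ and $A$. *)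

theory Defs
  imports "HOL-Algebra.Algebra"
begin

definition internal_direct_sum ::
    "('r, 'n) ring_scheme \<Rightarrow> 'i set \<Rightarrow> ('i \<Rightarrow> 'r set) \<Rightarrow> bool" where
  "internal_direct_sum R I A \<longleftrightarrow>
     (\<forall>i\<in>I. additive_subgroup (A i) R) \<and>
     (\<forall>r\<in>carrier R. \<exists>!f. f \<in> (\<Pi>\<^sub>E i\<in>I. A i) \<and> finite {i\<in>I. f i \<noteq> \<zero>\<^bsub>R\<^esub>} \<and>
        r = (\<Oplus>\<^bsub>R\<^esub>i\<in>{i\<in>I. f i \<noteq> \<zero>\<^bsub>R\<^esub>}. f i))"

(* For arbitrary subsets S, T of R, ideal_prod R S T is the set of all (nonempty) finite sums of
   products s * t with s in S and t in T; it is not restricted to ideals.  The components of a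
   grading contain zero, so allowing the empty sum would not change anything. *)
locale graded_ring = G: group G + R: ring R
  for G :: "('g, 'm) monoid_scheme" and R :: "('r, 'n) ring_scheme" and A :: "'g \<Rightarrow> 'r set" +
  assumes direct_sum: "internal_direct_sum R (carrier G) A"
    and graded_mult: "\<lbrakk>g \<in> carrier G; h \<in> carrier G\<rbrakk>
      \<Longrightarrow> ideal_prod R (A g) (A h) \<subseteq> A (g \<otimes>\<^bsub>G\<^esub> h)"

locale strongly_graded_ring = graded_ring +
  assumes strongly_graded_mult: "\<lbrakk>g \<in> carrier G; h \<in> carrier G\<rbrakk>
      \<Longrightarrow> ideal_prod R (A g) (A h) = A (g \<otimes>\<^bsub>G\<^esub> h)"

definition commutant :: "('r, 'n) ring_scheme \<Rightarrow> 'r set \<Rightarrow> 'r set" where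
  "commutant R S = {r \<in> carrier R. \<forall>s\<in>S. r \<otimes>\<^bsub>R\<^esub> s = s \<otimes>\<^bsub>R\<^esub> r}"

definition maximal_commutative :: "('r, 'n) ring_scheme \<Rightarrow> 'r set \<Rightarrow> bool" where
  "maximal_commutative R S \<longleftrightarrow> subcring S R \<and> commutant R S = S"

definition unit_decomposition ::
    "('g, 'm) monoid_scheme \<Rightarrow> ('r, 'n) ring_scheme \<Rightarrow> ('g \<Rightarrow> 'r set) \<Rightarrow> 'g \<Rightarrow>
     nat \<Rightarrow> (nat \<Rightarrow> 'r) \<Rightarrow> (nat \<Rightarrow> 'r) \<Rightarrow> bool" where
  "unit_decomposition G R A g n a b \<longleftrightarrow>
     a \<in> {..<n} \<rightarrow> A g \<and> b \<in> {..<n} \<rightarrow> A (inv\<^bsub>G\<^esub> g) \<and>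
     \<one>\<^bsub>R\<^esub> = (\<Oplus>\<^bsub>R\<^esub>i\<in>{..<n}. a i \<otimes>\<^bsub>R\<^esub> b i)"

(* Meaningful for g in G and x in the commutant of the identity component; there it does not
   depend on the chosen decomposition, see canonical_action_eq below. *)
definition canonical_action ::
    "('g, 'm) monoid_scheme \<Rightarrow> ('r, 'n) ring_scheme \<Rightarrow> ('g \<Rightarrow> 'r set) \<Rightarrow> 'g \<Rightarrow> 'r \<Rightarrow> 'r" where
  "canonical_action G R A g x =
     (let (n, a, b) = (SOME (n, a, b). unit_decomposition G R A g n a b)
      in (\<Oplus>\<^bsub>R\<^esub>i\<in>{..<n}. a i \<otimes>\<^bsub>R\<^esub> x \<otimes>\<^bsub>R\<^esub> b i))"

(* As in the source, the zero ring is not excluded from being simple or G-simple. *)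
definition simple_ring :: "('r, 'n) ring_scheme \<Rightarrow> bool" where
  "simple_ring R \<longleftrightarrow> ring R \<and> (\<forall>I. ideal I R \<longrightarrow> I = {\<zero>\<^bsub>R\<^esub>} \<or> I = carrier R)"

definition G_invariant ::
    "('g, 'm) monoid_scheme \<Rightarrow> ('g \<Rightarrow> 'r \<Rightarrow> 'r) \<Rightarrow> 'r set \<Rightarrow> bool" where
  "G_invariant G \<sigma> I \<longleftrightarrow> (\<forall>g\<in>carrier G. \<sigma> g ` I \<subseteq> I)"

definition G_simple_ring ::
    "('g, 'm) monoid_scheme \<Rightarrow> ('g \<Rightarrow> 'r \<Rightarrow> 'r) \<Rightarrow> ('r, 'n) ring_scheme \<Rightarrow> bool" where
  "G_simple_ring G \<sigma> R \<longleftrightarrow> ring R \<and>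
     (\<forall>I. ideal I R \<and> G_invariant G \<sigma> I \<longrightarrow> I = {\<zero>\<^bsub>R\<^esub>} \<or> I = carrier R)"

lemma ideal_prod_finite_sum:
  assumes "ring R" "S \<subseteq> carrier R" "T \<subseteq> carrier R" "x \<in> ideal_prod R S T"
  shows "\<exists>n a b. a \<in> {..<n::nat} \<rightarrow> S \<and> b \<in> {..<n} \<rightarrow> T \<and>
           x = (\<Oplus>\<^bsub>R\<^esub>i\<in>{..<n}. a i \<otimes>\<^bsub>R\<^esub> b i)"
  using assms(4)
proof induction
  case (prod i j)
  interpret ring R by fact
  have "i \<otimes>\<^bsub>R\<^esub> j = (\<Oplus>\<^bsub>R\<^esub>k\<in>{..<Suc 0}. i \<otimes>\<^bsub>R\<^esub> j)"
  proof -
    have c: "i \<otimes>\<^bsub>R\<^esub> j \<in> carrier R" using prod assms by auto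
    have "{..<Suc 0} = {0}" by auto
    then show ?thesis using finsum_insert[of "{}" 0 "\<lambda>_. i \<otimes>\<^bsub>R\<^esub> j"] c by simp
  qed
  then show ?case using prod by (intro exI[of _ "Suc 0"] exI[of _ "\<lambda>_. i"] exI[of _ "\<lambda>_. j"]) auto
next
  case (sum x y)
  interpret ring R by fact
  obtain n a b where x: "a \<in> {..<n::nat} \<rightarrow> S" "b \<in> {..<n} \<rightarrow> T"
      "x = (\<Oplus>\<^bsub>R\<^esub>i\<in>{..<n}. a i \<otimes>\<^bsub>R\<^esub> b i)" using sum by blast
  obtain m c d where y: "c \<in> {..<m::nat} \<rightarrow> S" "d \<in> {..<m} \<rightarrow> T"
      "y = (\<Oplus>\<^bsub>R\<^esub>i\<in>{..<m}. c i \<otimes>\<^bsub>R\<^esub> d i)" using sum by blast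
  define e where "e i = (if i < n then a i else c (i - n))" for i
  define f where "f i = (if i < n then b i else d (i - n))" for i
  have ab: "a i \<otimes>\<^bsub>R\<^esub> b i \<in> carrier R" if "i < n" for i
    using x(1,2) assms(2,3) that by (intro m_closed) auto
  have cd: "c i \<otimes>\<^bsub>R\<^esub> d i \<in> carrier R" if "i < m" for i
    using y(1,2) assms(2,3) that by (intro m_closed) auto
  have e: "e \<in> {..<n+m} \<rightarrow> S" and f: "f \<in> {..<n+m} \<rightarrow> T"
    using x(1,2) y(1,2) by (auto simp: e_def f_def Pi_iff)
  have ef: "(\<lambda>i. e i \<otimes>\<^bsub>R\<^esub> f i) \<in> {..<n+m} \<rightarrow> carrier R"
    using e f assms(2,3) by blast
  have U: "{..<n+m} = {..<n} \<union> (\<lambda>i. i + n) ` {..<m}"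
  proof (intro subset_antisym subsetI)
    fix i assume "i \<in> {..<n+m}"
    then show "i \<in> {..<n} \<union> (\<lambda>i. i + n) ` {..<m}"
      by (cases "i < n") (auto intro: image_eqI[of _ _ "i - n"])
  qed auto
  have "(\<Oplus>\<^bsub>R\<^esub>i\<in>{..<n+m}. e i \<otimes>\<^bsub>R\<^esub> f i) =
        (\<Oplus>\<^bsub>R\<^esub>i\<in>{..<n}. e i \<otimes>\<^bsub>R\<^esub> f i) \<oplus>\<^bsub>R\<^esub> (\<Oplus>\<^bsub>R\<^esub>i\<in>(\<lambda>i. i + n) ` {..<m}. e i \<otimes>\<^bsub>R\<^esub> f i)"
    unfolding U using ef unfolding U by (intro finsum_Un_disjoint) auto
  also have "(\<Oplus>\<^bsub>R\<^esub>i\<in>(\<lambda>i. i + n) ` {..<m}. e i \<otimes>\<^bsub>R\<^esub> f i) = (\<Oplus>\<^bsub>R\<^esub>i\<in>{..<m}. e (i+n) \<otimes>\<^bsub>R\<^esub> f (i+n))"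
    using ef unfolding U by (intro add.finprod_reindex) (auto simp: inj_on_def)
  also have "\<dots> = y"
    unfolding y(3) using cd by (intro finsum_cong') (auto simp: e_def f_def)
  also have "(\<Oplus>\<^bsub>R\<^esub>i\<in>{..<n}. e i \<otimes>\<^bsub>R\<^esub> f i) = x"
    unfolding x(3) using ab by (intro finsum_cong') (auto simp: e_def f_def)
  finally have "x \<oplus>\<^bsub>R\<^esub> y = (\<Oplus>\<^bsub>R\<^esub>i\<in>{..<n+m}. e i \<otimes>\<^bsub>R\<^esub> f i)" by (rule sym)
  with e f show ?case by blast
qed

context graded_ring
begin

lemma component_subset: "g \<in> carrier G \<Longrightarrow> A g \<subseteq> carrier R"
  using direct_sum unfolding internal_direct_sum_def
  by (auto dest!: additive_subgroup.a_subset)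

lemma component_mult:
  "\<lbrakk>g \<in> carrier G; h \<in> carrier G; x \<in> A g; y \<in> A h\<rbrakk> \<Longrightarrow> x \<otimes>\<^bsub>R\<^esub> y \<in> A (g \<otimes>\<^bsub>G\<^esub> h)"
  by (rule subsetD[OF graded_mult ideal_prod.prod])

lemma decomposition_sum_eq:
  assumes g: "g \<in> carrier G" and x: "x \<in> commutant R (A \<one>\<^bsub>G\<^esub>)"
    and 1: "unit_decomposition G R A g n a b" and 2: "unit_decomposition G R A g m c d"
  shows "(\<Oplus>\<^bsub>R\<^esub>i\<in>{..<n}. a i \<otimes>\<^bsub>R\<^esub> x \<otimes>\<^bsub>R\<^esub> b i) = (\<Oplus>\<^bsub>R\<^esub>j\<in>{..<m}. c j \<otimes>\<^bsub>R\<^esub> x \<otimes>\<^bsub>R\<^esub> d j)"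
proof -
  have xc: "x \<in> carrier R" using x by (simp add: commutant_def)
  have A: "a i \<in> A g" "b i \<in> A (inv\<^bsub>G\<^esub> g)" if "i < n" for i
    using 1 that unfolding unit_decomposition_def by auto
  have C: "c i \<in> A g" "d i \<in> A (inv\<^bsub>G\<^esub> g)" if "i < m" for i
    using 2 that unfolding unit_decomposition_def by auto
  have ac: "a i \<in> carrier R" "b i \<in> carrier R" if "i < n" for i
    using A[OF that] component_subset g by auto
  have cc: "c i \<in> carrier R" "d i \<in> carrier R" if "i < m" for i
    using C[OF that] component_subset g by auto
  have one1: "\<one>\<^bsub>R\<^esub> = (\<Oplus>\<^bsub>R\<^esub>i\<in>{..<n}. a i \<otimes>\<^bsub>R\<^esub> b i)"
    and one2: "\<one>\<^bsub>R\<^esub> = (\<Oplus>\<^bsub>R\<^esub>i\<in>{..<m}. c i \<otimes>\<^bsub>R\<^esub> d i)"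
    using 1 2 unfolding unit_decomposition_def by auto
  have comm: "x \<otimes>\<^bsub>R\<^esub> (b i \<otimes>\<^bsub>R\<^esub> c j) = (b i \<otimes>\<^bsub>R\<^esub> c j) \<otimes>\<^bsub>R\<^esub> x" if "i < n" "j < m" for i j
  proof -
    have "b i \<otimes>\<^bsub>R\<^esub> c j \<in> A \<one>\<^bsub>G\<^esub>"
      using component_mult[OF _ g A(2)[OF that(1)] C(1)[OF that(2)]] g by simp
    then show ?thesis using x by (auto simp: commutant_def)
  qed
  have t: "(a i \<otimes>\<^bsub>R\<^esub> x \<otimes>\<^bsub>R\<^esub> b i) \<otimes>\<^bsub>R\<^esub> (c j \<otimes>\<^bsub>R\<^esub> d j) = (a i \<otimes>\<^bsub>R\<^esub> b i) \<otimes>\<^bsub>R\<^esub> (c j \<otimes>\<^bsub>R\<^esub> x \<otimes>\<^bsub>R\<^esub> d j)"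
    if "i < n" "j < m" for i j
  proof -
    have "(a i \<otimes>\<^bsub>R\<^esub> x \<otimes>\<^bsub>R\<^esub> b i) \<otimes>\<^bsub>R\<^esub> (c j \<otimes>\<^bsub>R\<^esub> d j) = a i \<otimes>\<^bsub>R\<^esub> (x \<otimes>\<^bsub>R\<^esub> (b i \<otimes>\<^bsub>R\<^esub> c j)) \<otimes>\<^bsub>R\<^esub> d j"
      using ac[OF that(1)] cc[OF that(2)] xc by (simp add: R.m_assoc)
    also have "\<dots> = (a i \<otimes>\<^bsub>R\<^esub> b i) \<otimes>\<^bsub>R\<^esub> (c j \<otimes>\<^bsub>R\<^esub> x \<otimes>\<^bsub>R\<^esub> d j)"
      unfolding comm[OF that] using ac[OF that(1)] cc[OF that(2)] xc by (simp add: R.m_assoc)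
    finally show ?thesis .
  qed
  let ?s = "\<lambda>i. a i \<otimes>\<^bsub>R\<^esub> x \<otimes>\<^bsub>R\<^esub> b i" and ?t = "\<lambda>j. c j \<otimes>\<^bsub>R\<^esub> x \<otimes>\<^bsub>R\<^esub> d j"
  have s: "?s \<in> {..<n} \<rightarrow> carrier R" and t': "?t \<in> {..<m} \<rightarrow> carrier R"
    and u: "(\<lambda>i. a i \<otimes>\<^bsub>R\<^esub> b i) \<in> {..<n} \<rightarrow> carrier R" and v: "(\<lambda>j. c j \<otimes>\<^bsub>R\<^esub> d j) \<in> {..<m} \<rightarrow> carrier R"
    using ac cc xc by auto
  have "finsum R ?s {..<n} = finsum R ?s {..<n} \<otimes>\<^bsub>R\<^esub> \<one>\<^bsub>R\<^esub>"
    using s by (simp add: R.finsum_closed)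
  also have "\<dots> = (\<Oplus>\<^bsub>R\<^esub>i\<in>{..<n}. ?s i \<otimes>\<^bsub>R\<^esub> \<one>\<^bsub>R\<^esub>)"
    using s by (intro R.finsum_ldistr) auto
  also have "\<dots> = (\<Oplus>\<^bsub>R\<^esub>i\<in>{..<n}. (a i \<otimes>\<^bsub>R\<^esub> b i) \<otimes>\<^bsub>R\<^esub> finsum R ?t {..<m})"
  proof (intro R.finsum_cong')
    fix i assume "i \<in> {..<n}"
    then have i: "i < n" by simp
    have "?s i \<otimes>\<^bsub>R\<^esub> \<one>\<^bsub>R\<^esub> = (\<Oplus>\<^bsub>R\<^esub>j\<in>{..<m}. ?s i \<otimes>\<^bsub>R\<^esub> (c j \<otimes>\<^bsub>R\<^esub> d j))"
      unfolding one2 using v ac[OF i] xc by (intro R.finsum_rdistr) auto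
    also have "\<dots> = (\<Oplus>\<^bsub>R\<^esub>j\<in>{..<m}. (a i \<otimes>\<^bsub>R\<^esub> b i) \<otimes>\<^bsub>R\<^esub> ?t j)"
      using t[OF i] ac[OF i] t' by (intro R.finsum_cong') auto
    also have "\<dots> = (a i \<otimes>\<^bsub>R\<^esub> b i) \<otimes>\<^bsub>R\<^esub> finsum R ?t {..<m}"
      using t' ac[OF i] by (intro R.finsum_rdistr[symmetric]) auto
    finally show "?s i \<otimes>\<^bsub>R\<^esub> \<one>\<^bsub>R\<^esub> = (a i \<otimes>\<^bsub>R\<^esub> b i) \<otimes>\<^bsub>R\<^esub> finsum R ?t {..<m}" .
  qed (use ac u t' in \<open>auto intro: R.finsum_closed\<close>)
  also have "\<dots> = (\<Oplus>\<^bsub>R\<^esub>i\<in>{..<n}. a i \<otimes>\<^bsub>R\<^esub> b i) \<otimes>\<^bsub>R\<^esub> finsum R ?t {..<m}"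
    using u t' by (intro R.finsum_ldistr[symmetric]) (auto intro: R.finsum_closed)
  also have "\<dots> = finsum R ?t {..<m}"
    unfolding one1[symmetric] using t' by (simp add: R.finsum_closed)
  finally show ?thesis .
qed

lemma canonical_action_eq:
  assumes "g \<in> carrier G" "x \<in> commutant R (A \<one>\<^bsub>G\<^esub>)" "unit_decomposition G R A g n a b"
  shows "canonical_action G R A g x = (\<Oplus>\<^bsub>R\<^esub>i\<in>{..<n}. a i \<otimes>\<^bsub>R\<^esub> x \<otimes>\<^bsub>R\<^esub> b i)"
proof -
  define P where "P = (\<lambda>(n, a, b). unit_decomposition G R A g n a b)"
  obtain m c d where mcd: "Eps P = (m, c, d)" by (cases "Eps P")
  have "P (n, a, b)" using assms(3) by (simp add: P_def)
  then have "P (Eps P)" by (rule someI)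
  then have u: "unit_decomposition G R A g m c d" unfolding mcd by (simp add: P_def)
  have "canonical_action G R A g x = (\<Oplus>\<^bsub>R\<^esub>i\<in>{..<m}. c i \<otimes>\<^bsub>R\<^esub> x \<otimes>\<^bsub>R\<^esub> d i)"
    unfolding canonical_action_def P_def[symmetric] mcd by simp
  also have "\<dots> = (\<Oplus>\<^bsub>R\<^esub>i\<in>{..<n}. a i \<otimes>\<^bsub>R\<^esub> x \<otimes>\<^bsub>R\<^esub> b i)"
    by (rule decomposition_sum_eq[OF assms(1,2) u assms(3)])
  finally show ?thesis .
qed

end

lemma (in strongly_graded_ring) unit_decomposition_exists:
  assumes g: "g \<in> carrier G" and one: "\<one>\<^bsub>R\<^esub> \<in> A \<one>\<^bsub>G\<^esub>"
  shows "\<exists>n a b. unit_decomposition G R A g n a b"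
proof -
  have "\<one>\<^bsub>R\<^esub> \<in> ideal_prod R (A g) (A (inv\<^bsub>G\<^esub> g))"
    using one strongly_graded_mult[of g "inv\<^bsub>G\<^esub> g"] g by simp
  moreover have "A g \<subseteq> carrier R" "A (inv\<^bsub>G\<^esub> g) \<subseteq> carrier R"
    using component_subset g by simp_all
  ultimately show ?thesis
    unfolding unit_decomposition_def by (intro ideal_prod_finite_sum R.ring_axioms)
qed

end

theory Submission
  imports Defs
begin

text \<open>
  Write \<open>e\<close> for the neutral element and \<open>\<sigma>\<close> for the canonical action. Both directions compare
  ideals of \<open>R\<close> with ideals of \<open>A e\<close>.

  From \<open>R\<close> to \<open>A e\<close>: the action is characterised by \<open>\<sigma> g (x) r = r x\<close> for \<open>r\<close> in \<open>A g\<close>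
  (\<open>canonical_action_commute\<close>). So an invariant ideal \<open>I\<close> of \<open>A e\<close> can be moved past every
  homogeneous element, and the right ideal \<open>I R\<close> is two-sided (\<open>invariant_ideal_extends\<close>). Taking
  homogeneous parts of degree \<open>e\<close> shows that \<open>I R\<close> has no element of \<open>A e\<close> outside \<open>I\<close>
  (\<open>homogeneous_part_one_extension\<close>). If \<open>R\<close> is simple, then either \<open>I R\<close> is zero, and so is \<open>I\<close>, or
  \<open>I R\<close> contains the unit, and so does \<open>I\<close>.

  From \<open>A e\<close> to \<open>R\<close>: by definition \<open>\<sigma> g\<close> maps the intersection of \<open>A e\<close> with an ideal \<open>J\<close> of \<open>R\<close>
  into itself, and by \<open>G\<close>-simplicity this intersection is zero or contains the unit. It remains to see
  that \<open>J\<close> meets \<open>A e\<close> nontrivially as soon as \<open>J\<close> is nonzero (\<open>nonzero_ideal_meets_component_one\<close>).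
  Choose a nonzero element of \<open>J\<close> with as few nonzero homogeneous parts as possible. Strong grading
  permits a shift of its degrees so that the part of degree \<open>e\<close> is nonzero. Its commutator with an
  element of the commutative ring \<open>A e\<close> is again in \<open>J\<close>, but has lost the part of degree \<open>e\<close>, and hence
  vanishes by minimality. So the element lies in the commutant of \<open>A e\<close>, which is \<open>A e\<close>.
\<close>

section \<open>Ideals and sums in rings\<close>

context ring
begin

text \<open>Negatives come for free, being multiples by \<open>\<ominus> \<one>\<close>.\<close>

lemma idealI_no_minus:
  assumes "I \<subseteq> carrier R" "\<zero> \<in> I"
    and add: "\<And>x y. \<lbrakk>x \<in> I; y \<in> I\<rbrakk> \<Longrightarrow> x \<oplus> y \<in> I"
    and l: "\<And>x r. \<lbrakk>x \<in> I; r \<in> carrier R\<rbrakk> \<Longrightarrow> r \<otimes> x \<in> I"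
    and r: "\<And>x r. \<lbrakk>x \<in> I; r \<in> carrier R\<rbrakk> \<Longrightarrow> x \<otimes> r \<in> I"
  shows "ideal I R"
proof (rule idealI)
  show "subgroup I (add_monoid R)"
  proof (rule add.subgroupI)
    fix x assume x: "x \<in> I"
    then have "\<ominus> x = (\<ominus> \<one>) \<otimes> x"
      using assms(1) by (auto simp: l_minus)
    then show "\<ominus> x \<in> I"
      using l[OF x] by simp
  qed (use assms in auto)
qed (use ring_axioms l r in auto)

lemma finsum_in_additively_closed:
  assumes "H \<subseteq> carrier R" "\<zero> \<in> H" "\<And>x y. \<lbrakk>x \<in> H; y \<in> H\<rbrakk> \<Longrightarrow> x \<oplus> y \<in> H"
    and "finite S" "f \<in> S \<rightarrow> H"
  shows "finsum R f S \<in> H"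
  using assms(4,5)
proof (induction S rule: finite_induct)
  case (insert s S)
  then have "finsum R f (insert s S) = f s \<oplus> finsum R f S"
    using assms(1) by (intro finsum_insert) auto
  then show ?case using insert assms(3) by auto
qed (use assms(2) in simp)

end

section \<open>Homogeneous parts\<close>

context graded_ring
begin

definition is_decomposition :: "'r \<Rightarrow> ('g \<Rightarrow> 'r) \<Rightarrow> bool" where
  "is_decomposition r f \<longleftrightarrow> f \<in> (\<Pi>\<^sub>E g\<in>carrier G. A g) \<and>
     finite {g\<in>carrier G. f g \<noteq> \<zero>\<^bsub>R\<^esub>} \<and> r = (\<Oplus>\<^bsub>R\<^esub>g\<in>{g\<in>carrier G. f g \<noteq> \<zero>\<^bsub>R\<^esub>}. f g)"

definition homogeneous_part :: "'r \<Rightarrow> 'g \<Rightarrow> 'r" where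
  "homogeneous_part r = (THE f. is_decomposition r f)"

definition support :: "'r \<Rightarrow> 'g set" where
  "support r = {g \<in> carrier G. homogeneous_part r g \<noteq> \<zero>\<^bsub>R\<^esub>}"

lemma ex1_decomposition: "r \<in> carrier R \<Longrightarrow> \<exists>!f. is_decomposition r f"
  using direct_sum unfolding internal_direct_sum_def is_decomposition_def by blast

lemma is_decomposition_homogeneous_part:
  "r \<in> carrier R \<Longrightarrow> is_decomposition r (homogeneous_part r)"
  unfolding homogeneous_part_def by (rule theI'[OF ex1_decomposition])

lemma component_additive_subgroup: "g \<in> carrier G \<Longrightarrow> additive_subgroup (A g) R"
  using direct_sum unfolding internal_direct_sum_def by blast

lemma homogeneous_part_in: "\<lbrakk>r \<in> carrier R; g \<in> carrier G\<rbrakk> \<Longrightarrow> homogeneous_part r g \<in> A g"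
  using is_decomposition_homogeneous_part[of r] unfolding is_decomposition_def by auto

lemma homogeneous_part_closed:
  "\<lbrakk>r \<in> carrier R; g \<in> carrier G\<rbrakk> \<Longrightarrow> homogeneous_part r g \<in> carrier R"
  using homogeneous_part_in component_subset by blast

lemma finite_support: "r \<in> carrier R \<Longrightarrow> finite (support r)"
  using is_decomposition_homogeneous_part[of r]
  unfolding is_decomposition_def support_def by blast

lemma support_subset: "support r \<subseteq> carrier G"
  unfolding support_def by blast

lemma sum_homogeneous_parts:
  "r \<in> carrier R \<Longrightarrow> (\<Oplus>\<^bsub>R\<^esub>g\<in>support r. homogeneous_part r g) = r"
  using is_decomposition_homogeneous_part[of r]
  unfolding is_decomposition_def support_def by auto

lemma sum_homogeneous_parts_superset:
  assumes r: "r \<in> carrier R" and S: "finite S" "S \<subseteq> carrier G" "support r \<subseteq> S"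
  shows "(\<Oplus>\<^bsub>R\<^esub>g\<in>S. homogeneous_part r g) = r"
proof -
  have "finsum R (homogeneous_part r) S = finsum R (homogeneous_part r) (support r)"
    using S homogeneous_part_closed[OF r]
    by (intro R.add.finprod_mono_neutral_cong_right) (auto simp: support_def)
  then show ?thesis by (simp add: sum_homogeneous_parts[OF r])
qed

text \<open>Uniqueness of the decomposition: any way to write \<open>r\<close> as a finite sum of homogeneous elements
  of distinct degrees exhibits the homogeneous parts. All computations of homogeneous parts below go
  through this rule.\<close>

lemma homogeneous_part_eqI:
  assumes f: "\<And>g. g \<in> carrier G \<Longrightarrow> f g \<in> A g"
    and S: "finite S" "S \<subseteq> carrier G" "\<And>g. g \<in> carrier G - S \<Longrightarrow> f g = \<zero>\<^bsub>R\<^esub>"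
    and r: "r = (\<Oplus>\<^bsub>R\<^esub>g\<in>S. f g)"
    and k: "k \<in> carrier G"
  shows "homogeneous_part r k = f k"
proof -
  let ?f = "restrict f (carrier G)"
  let ?T = "{g \<in> carrier G. ?f g \<noteq> \<zero>\<^bsub>R\<^esub>}"
  have fc: "f g \<in> carrier R" if "g \<in> carrier G" for g
    using f[OF that] component_subset[OF that] by blast
  have rc: "r \<in> carrier R"
    unfolding r using fc S(2) by (intro R.finsum_closed) auto
  have T: "?T \<subseteq> S" using S(3) by force
  have "finite ?T" by (rule finite_subset[OF T S(1)])
  moreover have "finsum R f S = finsum R ?f ?T"
    using T S fc by (intro R.add.finprod_mono_neutral_cong_right) auto
  moreover have "?f \<in> (\<Pi>\<^sub>E g\<in>carrier G. A g)" using f by auto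
  ultimately have "is_decomposition r ?f"
    unfolding is_decomposition_def r by blast
  then have "homogeneous_part r = ?f"
    using ex1_decomposition[OF rc] is_decomposition_homogeneous_part[OF rc] by blast
  then show ?thesis using k by simp
qed

lemma homogeneous_part_of_homogeneous:
  assumes "g \<in> carrier G" "r \<in> A g"
  shows "homogeneous_part r g = r"
proof -
  have rc: "r \<in> carrier R" using assms component_subset by blast
  have "homogeneous_part r g = (if g = g then r else \<zero>\<^bsub>R\<^esub>)"
  proof (rule homogeneous_part_eqI[where S = "{g}" and f = "\<lambda>h. if h = g then r else \<zero>\<^bsub>R\<^esub>"])
    show "r = (\<Oplus>\<^bsub>R\<^esub>h\<in>{g}. if h = g then r else \<zero>\<^bsub>R\<^esub>)"
      using R.finsum_insert[of "{}" g "\<lambda>h. if h = g then r else \<zero>\<^bsub>R\<^esub>"] rc by simp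
  qed (use assms in \<open>auto intro: additive_subgroup.zero_closed[OF component_additive_subgroup]\<close>)
  then show ?thesis by simp
qed

lemma homogeneous_part_zero: "g \<in> carrier G \<Longrightarrow> homogeneous_part \<zero>\<^bsub>R\<^esub> g = \<zero>\<^bsub>R\<^esub>"
  by (intro homogeneous_part_of_homogeneous
      additive_subgroup.zero_closed[OF component_additive_subgroup])

lemma homogeneous_part_add:
  assumes r: "r \<in> carrier R" and s: "s \<in> carrier R" and g: "g \<in> carrier G"
  shows "homogeneous_part (r \<oplus>\<^bsub>R\<^esub> s) g = homogeneous_part r g \<oplus>\<^bsub>R\<^esub> homogeneous_part s g"
proof (rule homogeneous_part_eqI[OF _ _ _ _ _ g, where S = "support r \<union> support s"])
  let ?S = "support r \<union> support s"
  have S: "finite ?S" "?S \<subseteq> carrier G"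
    using finite_support r s support_subset by auto
  have "(\<Oplus>\<^bsub>R\<^esub>g\<in>?S. homogeneous_part r g \<oplus>\<^bsub>R\<^esub> homogeneous_part s g) =
        (\<Oplus>\<^bsub>R\<^esub>g\<in>?S. homogeneous_part r g) \<oplus>\<^bsub>R\<^esub> (\<Oplus>\<^bsub>R\<^esub>g\<in>?S. homogeneous_part s g)"
    using S homogeneous_part_closed r s by (intro R.finsum_addf) auto
  then show "r \<oplus>\<^bsub>R\<^esub> s = (\<Oplus>\<^bsub>R\<^esub>g\<in>?S. homogeneous_part r g \<oplus>\<^bsub>R\<^esub> homogeneous_part s g)"
    using sum_homogeneous_parts_superset r s S by simp
  show "homogeneous_part r g \<oplus>\<^bsub>R\<^esub> homogeneous_part s g \<in> A g" if "g \<in> carrier G" for g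
    using additive_subgroup.a_closed[OF component_additive_subgroup[OF that]]
      homogeneous_part_in r s that by blast
  show "finite ?S" "?S \<subseteq> carrier G" by (fact S)+
qed (simp add: support_def)

lemma homogeneous_part_mult_right:
  assumes r: "r \<in> carrier R" and h: "h \<in> carrier G" and b: "b \<in> A h" and k: "k \<in> carrier G"
  shows "homogeneous_part (r \<otimes>\<^bsub>R\<^esub> b) k = homogeneous_part r (k \<otimes>\<^bsub>G\<^esub> inv\<^bsub>G\<^esub> h) \<otimes>\<^bsub>R\<^esub> b"
proof -
  let ?f = "\<lambda>k. homogeneous_part r (k \<otimes>\<^bsub>G\<^esub> inv\<^bsub>G\<^esub> h) \<otimes>\<^bsub>R\<^esub> b"
  let ?S = "(\<lambda>g. g \<otimes>\<^bsub>G\<^esub> h) ` support r"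
  have bc: "b \<in> carrier R" using b h component_subset by blast
  have cancel: "k \<otimes>\<^bsub>G\<^esub> inv\<^bsub>G\<^esub> h \<otimes>\<^bsub>G\<^esub> h = k" if "k \<in> carrier G" for k
    using that h by (simp add: G.m_assoc)
  have cancel': "k \<otimes>\<^bsub>G\<^esub> h \<otimes>\<^bsub>G\<^esub> inv\<^bsub>G\<^esub> h = k" if "k \<in> carrier G" for k
    using that h by (simp add: G.m_assoc)
  have fA: "?f k \<in> A k" if "k \<in> carrier G" for k
    using component_mult[of "k \<otimes>\<^bsub>G\<^esub> inv\<^bsub>G\<^esub> h" h "homogeneous_part r (k \<otimes>\<^bsub>G\<^esub> inv\<^bsub>G\<^esub> h)" b]
      that h b r homogeneous_part_in cancel[OF that] by simp
  have "finsum R ?f ?S = (\<Oplus>\<^bsub>R\<^esub>g\<in>support r. ?f (g \<otimes>\<^bsub>G\<^esub> h))"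
  proof (rule R.add.finprod_reindex)
    show "?f \<in> ?S \<rightarrow> carrier R"
      using support_subset[of r] h r bc homogeneous_part_closed by auto
    show "inj_on (\<lambda>g. g \<otimes>\<^bsub>G\<^esub> h) (support r)"
      using support_subset[of r] h by (auto intro!: inj_onI simp: subset_eq)
  qed
  also have "\<dots> = (\<Oplus>\<^bsub>R\<^esub>g\<in>support r. homogeneous_part r g \<otimes>\<^bsub>R\<^esub> b)"
    using support_subset[of r] homogeneous_part_closed[OF r] bc
    by (intro R.finsum_cong') (auto simp: cancel' subset_eq)
  also have "\<dots> = (\<Oplus>\<^bsub>R\<^esub>g\<in>support r. homogeneous_part r g) \<otimes>\<^bsub>R\<^esub> b"
    using support_subset[of r] homogeneous_part_closed[OF r] bc finite_support[OF r]
    by (intro R.finsum_ldistr[symmetric]) auto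
  finally have sum: "r \<otimes>\<^bsub>R\<^esub> b = finsum R ?f ?S"
    by (simp add: sum_homogeneous_parts[OF r])
  show ?thesis
  proof (rule homogeneous_part_eqI[OF fA _ _ _ sum k])
    show "?f k = \<zero>\<^bsub>R\<^esub>" if "k \<in> carrier G - ?S" for k
    proof -
      have "k \<otimes>\<^bsub>G\<^esub> inv\<^bsub>G\<^esub> h \<notin> support r"
        using that cancel[of k] by (force intro: image_eqI)
      then show ?thesis using that h bc by (simp add: support_def)
    qed
  qed (use finite_support[OF r] support_subset[of r] h in auto)
qed

lemma homogeneous_part_mult_left:
  assumes r: "r \<in> carrier R" and h: "h \<in> carrier G" and b: "b \<in> A h" and k: "k \<in> carrier G"
  shows "homogeneous_part (b \<otimes>\<^bsub>R\<^esub> r) k = b \<otimes>\<^bsub>R\<^esub> homogeneous_part r (inv\<^bsub>G\<^esub> h \<otimes>\<^bsub>G\<^esub> k)"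
proof -
  let ?f = "\<lambda>k. b \<otimes>\<^bsub>R\<^esub> homogeneous_part r (inv\<^bsub>G\<^esub> h \<otimes>\<^bsub>G\<^esub> k)"
  let ?S = "(\<lambda>g. h \<otimes>\<^bsub>G\<^esub> g) ` support r"
  have bc: "b \<in> carrier R" using b h component_subset by blast
  have cancel: "h \<otimes>\<^bsub>G\<^esub> (inv\<^bsub>G\<^esub> h \<otimes>\<^bsub>G\<^esub> k) = k" if "k \<in> carrier G" for k
    using that h by (simp flip: G.m_assoc)
  have cancel': "inv\<^bsub>G\<^esub> h \<otimes>\<^bsub>G\<^esub> (h \<otimes>\<^bsub>G\<^esub> k) = k" if "k \<in> carrier G" for k
    using that h by (simp flip: G.m_assoc)
  have fA: "?f k \<in> A k" if "k \<in> carrier G" for k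
    using component_mult[of h "inv\<^bsub>G\<^esub> h \<otimes>\<^bsub>G\<^esub> k" b "homogeneous_part r (inv\<^bsub>G\<^esub> h \<otimes>\<^bsub>G\<^esub> k)"]
      that h b r homogeneous_part_in cancel[OF that] by simp
  have "finsum R ?f ?S = (\<Oplus>\<^bsub>R\<^esub>g\<in>support r. ?f (h \<otimes>\<^bsub>G\<^esub> g))"
  proof (rule R.add.finprod_reindex)
    show "?f \<in> ?S \<rightarrow> carrier R"
      using support_subset[of r] h r bc homogeneous_part_closed by auto
    show "inj_on (\<lambda>g. h \<otimes>\<^bsub>G\<^esub> g) (support r)"
      using support_subset[of r] h by (auto intro!: inj_onI simp: subset_eq)
  qed
  also have "\<dots> = (\<Oplus>\<^bsub>R\<^esub>g\<in>support r. b \<otimes>\<^bsub>R\<^esub> homogeneous_part r g)"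
    using support_subset[of r] homogeneous_part_closed[OF r] bc
    by (intro R.finsum_cong') (auto simp: cancel' subset_eq)
  also have "\<dots> = b \<otimes>\<^bsub>R\<^esub> (\<Oplus>\<^bsub>R\<^esub>g\<in>support r. homogeneous_part r g)"
    using support_subset[of r] homogeneous_part_closed[OF r] bc finite_support[OF r]
    by (intro R.finsum_rdistr[symmetric]) auto
  finally have sum: "b \<otimes>\<^bsub>R\<^esub> r = finsum R ?f ?S"
    by (simp add: sum_homogeneous_parts[OF r])
  show ?thesis
  proof (rule homogeneous_part_eqI[OF fA _ _ _ sum k])
    show "?f k = \<zero>\<^bsub>R\<^esub>" if "k \<in> carrier G - ?S" for k
    proof -
      have "inv\<^bsub>G\<^esub> h \<otimes>\<^bsub>G\<^esub> k \<notin> support r"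
        using that cancel[of k] by (force intro: image_eqI)
      then show ?thesis using that h bc by (simp add: support_def)
    qed
  qed (use finite_support[OF r] support_subset[of r] h in auto)
qed

lemma component_one_bimodule:
  assumes "s \<in> A \<one>\<^bsub>G\<^esub>" "r \<in> carrier R" "k \<in> carrier G"
  shows "homogeneous_part (s \<otimes>\<^bsub>R\<^esub> r) k = s \<otimes>\<^bsub>R\<^esub> homogeneous_part r k"
    and "homogeneous_part (r \<otimes>\<^bsub>R\<^esub> s) k = homogeneous_part r k \<otimes>\<^bsub>R\<^esub> s"
  using homogeneous_part_mult_left[of r "\<one>\<^bsub>G\<^esub>" s k] homogeneous_part_mult_right[of r "\<one>\<^bsub>G\<^esub>" s k]
    assms by simp_all

end

section \<open>The canonical action and extension of invariant ideals\<close>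

context strongly_graded_ring
begin

text \<open>If the unit is the sum of the \<open>a i \<otimes> b i\<close>, then \<open>x\<close> commutes with \<open>b i \<otimes> r\<close>, which has degree
  \<open>\<one>\<close>. So \<open>a i \<otimes> x \<otimes> b i \<otimes> r = a i \<otimes> b i \<otimes> r \<otimes> x\<close>, and summation gives \<open>r \<otimes> x\<close>.\<close>

lemma canonical_action_commute:
  assumes one: "\<one>\<^bsub>R\<^esub> \<in> A \<one>\<^bsub>G\<^esub>" and x: "x \<in> commutant R (A \<one>\<^bsub>G\<^esub>)"
    and g: "g \<in> carrier G" and r: "r \<in> A g"
  shows "canonical_action G R A g x \<otimes>\<^bsub>R\<^esub> r = r \<otimes>\<^bsub>R\<^esub> x"
proof -
  obtain n a b where u: "unit_decomposition G R A g n a b"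
    using unit_decomposition_exists[OF g one] by blast
  then have ab: "a i \<in> A g" "b i \<in> A (inv\<^bsub>G\<^esub> g)" if "i < n" for i
    using that unfolding unit_decomposition_def by auto
  have c: "a i \<in> carrier R" "b i \<in> carrier R" if "i < n" for i
    using ab[OF that] component_subset g by auto
  have unit: "\<one>\<^bsub>R\<^esub> = (\<Oplus>\<^bsub>R\<^esub>i\<in>{..<n}. a i \<otimes>\<^bsub>R\<^esub> b i)"
    using u unfolding unit_decomposition_def by blast
  have xc: "x \<in> carrier R" using x by (simp add: commutant_def)
  have rc: "r \<in> carrier R" using r g component_subset by blast
  have eq: "a i \<otimes>\<^bsub>R\<^esub> x \<otimes>\<^bsub>R\<^esub> b i \<otimes>\<^bsub>R\<^esub> r = a i \<otimes>\<^bsub>R\<^esub> b i \<otimes>\<^bsub>R\<^esub> (r \<otimes>\<^bsub>R\<^esub> x)" if i: "i < n" for i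
  proof -
    have "b i \<otimes>\<^bsub>R\<^esub> r \<in> A \<one>\<^bsub>G\<^esub>"
      using component_mult[OF _ g ab(2)[OF i] r] g by simp
    then have "x \<otimes>\<^bsub>R\<^esub> (b i \<otimes>\<^bsub>R\<^esub> r) = (b i \<otimes>\<^bsub>R\<^esub> r) \<otimes>\<^bsub>R\<^esub> x"
      using x by (simp add: commutant_def)
    then show ?thesis using c[OF i] xc rc by (simp add: R.m_assoc)
  qed
  have "canonical_action G R A g x \<otimes>\<^bsub>R\<^esub> r = (\<Oplus>\<^bsub>R\<^esub>i\<in>{..<n}. a i \<otimes>\<^bsub>R\<^esub> x \<otimes>\<^bsub>R\<^esub> b i) \<otimes>\<^bsub>R\<^esub> r"
    by (simp add: canonical_action_eq[OF g x u])
  also have "\<dots> = (\<Oplus>\<^bsub>R\<^esub>i\<in>{..<n}. a i \<otimes>\<^bsub>R\<^esub> x \<otimes>\<^bsub>R\<^esub> b i \<otimes>\<^bsub>R\<^esub> r)"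
    using c xc rc by (intro R.finsum_ldistr) auto
  also have "\<dots> = (\<Oplus>\<^bsub>R\<^esub>i\<in>{..<n}. a i \<otimes>\<^bsub>R\<^esub> b i \<otimes>\<^bsub>R\<^esub> (r \<otimes>\<^bsub>R\<^esub> x))"
    using c xc rc eq by (intro R.finsum_cong') auto
  also have "\<dots> = (\<Oplus>\<^bsub>R\<^esub>i\<in>{..<n}. a i \<otimes>\<^bsub>R\<^esub> b i) \<otimes>\<^bsub>R\<^esub> (r \<otimes>\<^bsub>R\<^esub> x)"
    using c xc rc by (intro R.finsum_ldistr[symmetric]) auto
  also have "\<dots> = r \<otimes>\<^bsub>R\<^esub> x"
    using xc rc by (simp flip: unit)
  finally show ?thesis .
qed

text \<open>Left multiplication by a homogeneous \<open>r\<close> of degree \<open>g\<close> turns \<open>x \<in> I\<close> into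
  \<open>\<sigma> g x \<otimes> r\<close> with \<open>\<sigma> g x \<in> I\<close>.\<close>

lemma invariant_ideal_extends:
  assumes one: "\<one>\<^bsub>R\<^esub> \<in> A \<one>\<^bsub>G\<^esub>" and central: "I \<subseteq> commutant R (A \<one>\<^bsub>G\<^esub>)"
    and zero: "\<zero>\<^bsub>R\<^esub> \<in> I" and inv: "G_invariant G (canonical_action G R A) I"
  shows "ideal (ideal_prod R I (carrier R)) R"
proof (rule R.idealI_no_minus)
  let ?J = "ideal_prod R I (carrier R)"
  have Ic: "I \<subseteq> carrier R" using central by (auto simp: commutant_def)
  show sub: "?J \<subseteq> carrier R"
  proof
    fix x assume "x \<in> ?J"
    then show "x \<in> carrier R" by induction (use Ic in auto)
  qed
  have "\<zero>\<^bsub>R\<^esub> \<otimes>\<^bsub>R\<^esub> \<zero>\<^bsub>R\<^esub> \<in> ?J" using zero by (intro ideal_prod.prod) auto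
  then show zJ: "\<zero>\<^bsub>R\<^esub> \<in> ?J" by simp
  show add: "x \<oplus>\<^bsub>R\<^esub> y \<in> ?J" if "x \<in> ?J" "y \<in> ?J" for x y
    using that by (rule ideal_prod.sum)
  show right: "x \<otimes>\<^bsub>R\<^esub> r \<in> ?J" if "x \<in> ?J" and r: "r \<in> carrier R" for x r
    using that(1)
  proof induction
    case (prod i s)
    then have "i \<otimes>\<^bsub>R\<^esub> s \<otimes>\<^bsub>R\<^esub> r = i \<otimes>\<^bsub>R\<^esub> (s \<otimes>\<^bsub>R\<^esub> r)"
      using Ic r by (intro R.m_assoc) auto
    then show ?case using prod r by (auto intro!: ideal_prod.prod)
  next
    case (sum x y)
    have "(x \<oplus>\<^bsub>R\<^esub> y) \<otimes>\<^bsub>R\<^esub> r = x \<otimes>\<^bsub>R\<^esub> r \<oplus>\<^bsub>R\<^esub> y \<otimes>\<^bsub>R\<^esub> r"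
      using sum(1,2)[THEN subsetD[OF sub]] r by (rule R.l_distr)
    then show ?case using add[OF sum(3,4)] by simp
  qed
  have gen: "r \<otimes>\<^bsub>R\<^esub> i \<in> ?J" if i: "i \<in> I" and r: "r \<in> carrier R" for i r
  proof -
    have ic: "i \<in> carrier R" using i Ic by blast
    have "r \<otimes>\<^bsub>R\<^esub> i = (\<Oplus>\<^bsub>R\<^esub>g\<in>support r. homogeneous_part r g) \<otimes>\<^bsub>R\<^esub> i"
      by (simp add: sum_homogeneous_parts[OF r])
    also have "\<dots> = (\<Oplus>\<^bsub>R\<^esub>g\<in>support r. homogeneous_part r g \<otimes>\<^bsub>R\<^esub> i)"
      using support_subset[of r] homogeneous_part_closed[OF r] ic finite_support[OF r]
      by (intro R.finsum_ldistr) auto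
    also have "\<dots> \<in> ?J"
    proof (rule R.finsum_in_additively_closed[OF sub zJ add finite_support[OF r]])
      show "(\<lambda>g. homogeneous_part r g \<otimes>\<^bsub>R\<^esub> i) \<in> support r \<rightarrow> ?J"
      proof
        fix g assume "g \<in> support r"
        then have g: "g \<in> carrier G" using support_subset by blast
        have "canonical_action G R A g i \<in> I"
          using inv i g unfolding G_invariant_def by blast
        then have "canonical_action G R A g i \<otimes>\<^bsub>R\<^esub> homogeneous_part r g \<in> ?J"
          using homogeneous_part_closed[OF r g] by (intro ideal_prod.prod)
        then show "homogeneous_part r g \<otimes>\<^bsub>R\<^esub> i \<in> ?J"
          using canonical_action_commute[OF one _ g homogeneous_part_in[OF r g]] central i by auto
      qed
    qed
    finally show ?thesis .
  qed
  show "r \<otimes>\<^bsub>R\<^esub> x \<in> ?J" if "x \<in> ?J" and r: "r \<in> carrier R" for x r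
    using that(1)
  proof induction
    case (prod i s)
    then have "r \<otimes>\<^bsub>R\<^esub> (i \<otimes>\<^bsub>R\<^esub> s) = r \<otimes>\<^bsub>R\<^esub> i \<otimes>\<^bsub>R\<^esub> s"
      using Ic r by (intro R.m_assoc[symmetric]) auto
    then show ?case using right[OF gen[OF prod(1) r] prod(2)] by simp
  next
    case (sum x y)
    have "r \<otimes>\<^bsub>R\<^esub> (x \<oplus>\<^bsub>R\<^esub> y) = r \<otimes>\<^bsub>R\<^esub> x \<oplus>\<^bsub>R\<^esub> r \<otimes>\<^bsub>R\<^esub> y"
      using sum(1,2)[THEN subsetD[OF sub]] r by (rule R.r_distr)
    then show ?case using add[OF sum(3,4)] by simp
  qed
qed

lemma homogeneous_part_one_extension:
  assumes I: "ideal I (R\<lparr>carrier := A \<one>\<^bsub>G\<^esub>\<rparr>)" and x: "x \<in> ideal_prod R I (carrier R)"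
  shows "homogeneous_part x \<one>\<^bsub>G\<^esub> \<in> I"
proof -
  interpret I: ideal I "R\<lparr>carrier := A \<one>\<^bsub>G\<^esub>\<rparr>" by fact
  have IA: "I \<subseteq> A \<one>\<^bsub>G\<^esub>" using I.a_subset by simp
  have Ic: "I \<subseteq> carrier R" using IA component_subset by auto
  have "x \<in> carrier R \<and> homogeneous_part x \<one>\<^bsub>G\<^esub> \<in> I"
    using x
  proof induction
    case (prod i s)
    then have "homogeneous_part (i \<otimes>\<^bsub>R\<^esub> s) \<one>\<^bsub>G\<^esub> = i \<otimes>\<^bsub>R\<^esub> homogeneous_part s \<one>\<^bsub>G\<^esub>"
      using IA by (intro component_one_bimodule) auto
    moreover have "i \<otimes>\<^bsub>R\<^esub> homogeneous_part s \<one>\<^bsub>G\<^esub> \<in> I"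
      using I.I_r_closed[of i "homogeneous_part s \<one>\<^bsub>G\<^esub>"] prod homogeneous_part_in by simp
    ultimately show ?case using prod Ic by auto
  next
    case (sum x y)
    then show ?case using additive_subgroup.a_closed[OF I.is_additive_subgroup]
      by (auto simp: homogeneous_part_add)
  qed
  then show ?thesis ..
qed

section \<open>Contraction of ideals to the identity component\<close>

text \<open>The defining sums \<open>a i \<otimes> x \<otimes> b i\<close> stay in the ideal, and also in degree \<open>\<one>\<close>.\<close>

lemma contraction_invariant:
  assumes one: "\<one>\<^bsub>R\<^esub> \<in> A \<one>\<^bsub>G\<^esub>" and comm: "A \<one>\<^bsub>G\<^esub> \<subseteq> commutant R (A \<one>\<^bsub>G\<^esub>)"
    and J: "ideal J R"
  shows "G_invariant G (canonical_action G R A) (J \<inter> A \<one>\<^bsub>G\<^esub>)"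
  unfolding G_invariant_def
proof (intro ballI image_subsetI)
  fix g x assume g: "g \<in> carrier G" and x: "x \<in> J \<inter> A \<one>\<^bsub>G\<^esub>"
  interpret J: ideal J R by fact
  interpret A1: additive_subgroup "A \<one>\<^bsub>G\<^esub>" R by (simp add: component_additive_subgroup)
  obtain n a b where u: "unit_decomposition G R A g n a b"
    using unit_decomposition_exists[OF g one] by blast
  then have ab: "a i \<in> A g" "b i \<in> A (inv\<^bsub>G\<^esub> g)" if "i < n" for i
    using that unfolding unit_decomposition_def by auto
  have c: "a i \<in> carrier R" "b i \<in> carrier R" if "i < n" for i
    using ab[OF that] component_subset g by auto
  have summand: "a i \<otimes>\<^bsub>R\<^esub> x \<otimes>\<^bsub>R\<^esub> b i \<in> J \<inter> A \<one>\<^bsub>G\<^esub>" if i: "i < n" for i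
  proof
    show "a i \<otimes>\<^bsub>R\<^esub> x \<otimes>\<^bsub>R\<^esub> b i \<in> J"
      using x c[OF i] by (intro J.I_r_closed J.I_l_closed) auto
    have "a i \<otimes>\<^bsub>R\<^esub> x \<in> A g"
      using component_mult[OF g _ ab(1)[OF i], of "\<one>\<^bsub>G\<^esub>" x] x g by simp
    then show "a i \<otimes>\<^bsub>R\<^esub> x \<otimes>\<^bsub>R\<^esub> b i \<in> A \<one>\<^bsub>G\<^esub>"
      using component_mult[OF g _ _ ab(2)[OF i]] g by simp
  qed
  have "(\<Oplus>\<^bsub>R\<^esub>i\<in>{..<n}. a i \<otimes>\<^bsub>R\<^esub> x \<otimes>\<^bsub>R\<^esub> b i) \<in> J \<inter> A \<one>\<^bsub>G\<^esub>"
    using summand J.a_subset by (intro R.finsum_in_additively_closed) auto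
  moreover have "canonical_action G R A g x = (\<Oplus>\<^bsub>R\<^esub>i\<in>{..<n}. a i \<otimes>\<^bsub>R\<^esub> x \<otimes>\<^bsub>R\<^esub> b i)"
    using x comm by (intro canonical_action_eq[OF g _ u]) auto
  ultimately show "canonical_action G R A g x \<in> J \<inter> A \<one>\<^bsub>G\<^esub>" by simp
qed

lemma contraction_ideal:
  assumes S: "subring (A \<one>\<^bsub>G\<^esub>) R" and J: "ideal J R"
  shows "ideal (J \<inter> A \<one>\<^bsub>G\<^esub>) (R\<lparr>carrier := A \<one>\<^bsub>G\<^esub>\<rparr>)"
proof -
  interpret J: ideal J R by fact
  have "A \<one>\<^bsub>G\<^esub> \<subseteq> carrier R" by (rule subringE(1)[OF S])
  then show ?thesis
    using subringE(2,6,7)[OF S]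
    by (intro ring.idealI_no_minus[OF R.subring_is_ring[OF S]])
      (auto intro: J.I_l_closed J.I_r_closed)
qed

text \<open>The shift used in the minimality argument: since \<open>r g\<close>, the part of degree \<open>g\<close>, is the sum of
  the \<open>r g \<otimes> a i \<otimes> b i\<close> with \<open>a i\<close> of degree \<open>inv g\<close>, not all \<open>r g \<otimes> a i\<close> vanish.
  Multiplication by \<open>a i\<close> shifts all degrees alike, so the support does not grow.\<close>

lemma shift_to_degree_one:
  assumes one: "\<one>\<^bsub>R\<^esub> \<in> A \<one>\<^bsub>G\<^esub>" and r: "r \<in> carrier R" "r \<noteq> \<zero>\<^bsub>R\<^esub>"
  obtains c where "c \<in> carrier R" "homogeneous_part (r \<otimes>\<^bsub>R\<^esub> c) \<one>\<^bsub>G\<^esub> \<noteq> \<zero>\<^bsub>R\<^esub>"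
    "card (support (r \<otimes>\<^bsub>R\<^esub> c)) \<le> card (support r)"
proof -
  have "support r \<noteq> {}" using sum_homogeneous_parts[OF r(1)] r(2) by auto
  then obtain g where g: "g \<in> carrier G" and nz: "homogeneous_part r g \<noteq> \<zero>\<^bsub>R\<^esub>"
    unfolding support_def by auto
  have rg: "homogeneous_part r g \<in> carrier R" by (rule homogeneous_part_closed[OF r(1) g])
  obtain n a b where u: "unit_decomposition G R A (inv\<^bsub>G\<^esub> g) n a b"
    using unit_decomposition_exists[OF _ one] g by blast
  then have ab: "a i \<in> A (inv\<^bsub>G\<^esub> g)" "b i \<in> A g" if "i < n" for i
    using that g unfolding unit_decomposition_def by auto
  have c: "a i \<in> carrier R" "b i \<in> carrier R" if "i < n" for i
    using ab[OF that] component_subset g by auto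
  have unit: "\<one>\<^bsub>R\<^esub> = (\<Oplus>\<^bsub>R\<^esub>i\<in>{..<n}. a i \<otimes>\<^bsub>R\<^esub> b i)"
    using u unfolding unit_decomposition_def by blast
  have "\<exists>i<n. homogeneous_part r g \<otimes>\<^bsub>R\<^esub> a i \<noteq> \<zero>\<^bsub>R\<^esub>"
  proof (rule ccontr)
    assume "\<not> ?thesis"
    then have z: "homogeneous_part r g \<otimes>\<^bsub>R\<^esub> a i = \<zero>\<^bsub>R\<^esub>" if "i < n" for i
      using that by blast
    have "homogeneous_part r g = homogeneous_part r g \<otimes>\<^bsub>R\<^esub> (\<Oplus>\<^bsub>R\<^esub>i\<in>{..<n}. a i \<otimes>\<^bsub>R\<^esub> b i)"
      using rg by (simp flip: unit)
    also have "\<dots> = (\<Oplus>\<^bsub>R\<^esub>i\<in>{..<n}. homogeneous_part r g \<otimes>\<^bsub>R\<^esub> (a i \<otimes>\<^bsub>R\<^esub> b i))"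
      using rg c by (intro R.finsum_rdistr) auto
    also have "\<dots> = (\<Oplus>\<^bsub>R\<^esub>i\<in>{..<n}. \<zero>\<^bsub>R\<^esub>)"
      using rg c z by (intro R.finsum_cong') (auto simp flip: R.m_assoc)
    finally show False using nz by simp
  qed
  then obtain i where i: "i < n" and nzi: "homogeneous_part r g \<otimes>\<^bsub>R\<^esub> a i \<noteq> \<zero>\<^bsub>R\<^esub>" by blast
  have part: "homogeneous_part (r \<otimes>\<^bsub>R\<^esub> a i) k = homogeneous_part r (k \<otimes>\<^bsub>G\<^esub> g) \<otimes>\<^bsub>R\<^esub> a i"
    if "k \<in> carrier G" for k
    using homogeneous_part_mult_right[OF r(1) _ ab(1)[OF i] that] g by simp
  have "(\<lambda>k. k \<otimes>\<^bsub>G\<^esub> g) ` support (r \<otimes>\<^bsub>R\<^esub> a i) \<subseteq> support r"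
    using g c[OF i] by (auto simp: support_def part)
  then have "card (support (r \<otimes>\<^bsub>R\<^esub> a i)) \<le> card (support r)"
    using g support_subset[of "r \<otimes>\<^bsub>R\<^esub> a i"] finite_support[OF r(1)]
    by (intro card_inj_on_le[of "\<lambda>k. k \<otimes>\<^bsub>G\<^esub> g"]) (auto intro!: inj_onI simp: subset_eq)
  moreover have "homogeneous_part (r \<otimes>\<^bsub>R\<^esub> a i) \<one>\<^bsub>G\<^esub> \<noteq> \<zero>\<^bsub>R\<^esub>"
    using nzi g by (simp add: part)
  ultimately show ?thesis using that c[OF i] by blast
qed

text \<open>An element of minimal support, shifted so that its part of degree \<open>\<one>\<close> is nonzero, commutes with
  \<open>A \<one>\<close>, because its commutators have strictly smaller support.\<close>

lemma nonzero_ideal_meets_component_one: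
  assumes mc: "maximal_commutative R (A \<one>\<^bsub>G\<^esub>)" and J: "ideal J R" and J0: "J \<noteq> {\<zero>\<^bsub>R\<^esub>}"
  shows "J \<inter> A \<one>\<^bsub>G\<^esub> \<noteq> {\<zero>\<^bsub>R\<^esub>}"
proof -
  interpret J: ideal J R by fact
  interpret S: subcring "A \<one>\<^bsub>G\<^esub>" R using mc by (simp add: maximal_commutative_def)
  have sr: "subring (A \<one>\<^bsub>G\<^esub>) R" by (rule S.subring_axioms)
  obtain r where r: "r \<in> J" "r \<noteq> \<zero>\<^bsub>R\<^esub>"
    and min: "\<And>s. \<lbrakk>s \<in> J; s \<noteq> \<zero>\<^bsub>R\<^esub>\<rbrakk> \<Longrightarrow> card (support r) \<le> card (support s)"
  proof -
    obtain r0 where "r0 \<in> J \<and> r0 \<noteq> \<zero>\<^bsub>R\<^esub>" using J0 J.zero_closed by blast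
    from ex_has_least_nat[of "\<lambda>r. r \<in> J \<and> r \<noteq> \<zero>\<^bsub>R\<^esub>", OF this, of "\<lambda>r. card (support r)"]
    show ?thesis using that by blast
  qed
  have rc: "r \<in> carrier R" using r(1) J.a_subset by blast
  obtain c where c: "c \<in> carrier R" and nz: "homogeneous_part (r \<otimes>\<^bsub>R\<^esub> c) \<one>\<^bsub>G\<^esub> \<noteq> \<zero>\<^bsub>R\<^esub>"
    and card: "card (support (r \<otimes>\<^bsub>R\<^esub> c)) \<le> card (support r)"
    using shift_to_degree_one[OF subringE(3)[OF sr] rc r(2)] by blast
  define t where "t = r \<otimes>\<^bsub>R\<^esub> c"
  have tJ: "t \<in> J" unfolding t_def using r(1) c by (rule J.I_r_closed)
  have tc: "t \<in> carrier R" using tJ J.a_subset by blast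
  have t1: "homogeneous_part t \<one>\<^bsub>G\<^esub> \<in> A \<one>\<^bsub>G\<^esub>" using tc by (intro homogeneous_part_in) auto
  have t0: "t \<noteq> \<zero>\<^bsub>R\<^esub>" using nz homogeneous_part_zero[of "\<one>\<^bsub>G\<^esub>"] unfolding t_def by auto
  have commute: "t \<otimes>\<^bsub>R\<^esub> s = s \<otimes>\<^bsub>R\<^esub> t" if s: "s \<in> A \<one>\<^bsub>G\<^esub>" for s
  proof -
    have sc: "s \<in> carrier R" using s subringE(1)[OF sr] by blast
    have ns: "\<ominus>\<^bsub>R\<^esub> s \<in> A \<one>\<^bsub>G\<^esub>" using s by (rule subringE(5)[OF sr])
    define d where "d = s \<otimes>\<^bsub>R\<^esub> t \<oplus>\<^bsub>R\<^esub> t \<otimes>\<^bsub>R\<^esub> (\<ominus>\<^bsub>R\<^esub> s)"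
    have dJ: "d \<in> J" unfolding d_def using tJ sc
      by (intro J.a_closed J.I_l_closed J.I_r_closed) auto
    have part: "homogeneous_part d k =
        s \<otimes>\<^bsub>R\<^esub> homogeneous_part t k \<oplus>\<^bsub>R\<^esub> homogeneous_part t k \<otimes>\<^bsub>R\<^esub> (\<ominus>\<^bsub>R\<^esub> s)"
      if "k \<in> carrier G" for k
      unfolding d_def using tc sc that
      by (simp add: homogeneous_part_add component_one_bimodule(1)[OF s]
          component_one_bimodule(2)[OF ns])
    have "support d \<subseteq> support t"
      using sc by (auto simp: support_def part)
    moreover have "homogeneous_part d \<one>\<^bsub>G\<^esub> = \<zero>\<^bsub>R\<^esub>"
    proof -
      have "homogeneous_part t \<one>\<^bsub>G\<^esub> \<in> carrier R" using t1 subringE(1)[OF sr] by blast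
      then show ?thesis
        using S.sub_m_comm[OF s t1] sc by (simp add: part R.r_minus R.r_neg)
    qed
    ultimately have "support d \<subset> support t"
      using nz unfolding t_def support_def by auto
    then have "card (support d) < card (support t)"
      by (rule psubset_card_mono[OF finite_support[OF tc]])
    then have "d = \<zero>\<^bsub>R\<^esub>" using min[OF dJ] card unfolding t_def by linarith
    then have "s \<otimes>\<^bsub>R\<^esub> t \<ominus>\<^bsub>R\<^esub> t \<otimes>\<^bsub>R\<^esub> s = \<zero>\<^bsub>R\<^esub>"
      unfolding d_def using tc sc by (simp add: R.r_minus a_minus_def)
    then show ?thesis using tc sc by (simp add: R.r_right_minus_eq)
  qed
  have "t \<in> commutant R (A \<one>\<^bsub>G\<^esub>)" using tc commute by (simp add: commutant_def)
  then have "t \<in> A \<one>\<^bsub>G\<^esub>" using mc by (simp add: maximal_commutative_def)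
  then show ?thesis using tJ t0 by blast
qed

end

section \<open>Simplicity\<close>

theorem theorem6p7:
  fixes G :: "('g, 'm) monoid_scheme" and R :: "('r, 'n) ring_scheme" and A :: "'g \<Rightarrow> 'r set"
  assumes "strongly_graded_ring G R A"
    and "maximal_commutative R (A \<one>\<^bsub>G\<^esub>)"
  shows "G_simple_ring G (canonical_action G R A) (R\<lparr>carrier := A \<one>\<^bsub>G\<^esub>\<rparr>) \<longleftrightarrow> simple_ring R"
proof -
  interpret strongly_graded_ring G R A by fact
  interpret S: subcring "A \<one>\<^bsub>G\<^esub>" R using assms(2) by (simp add: maximal_commutative_def)
  have sr: "subring (A \<one>\<^bsub>G\<^esub>) R" by (rule S.subring_axioms)
  have one: "\<one>\<^bsub>R\<^esub> \<in> A \<one>\<^bsub>G\<^esub>" by (rule subringE(3)[OF sr])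
  have comm: "A \<one>\<^bsub>G\<^esub> = commutant R (A \<one>\<^bsub>G\<^esub>)"
    using assms(2) by (simp add: maximal_commutative_def)
  show ?thesis
  proof
    assume gs: "G_simple_ring G (canonical_action G R A) (R\<lparr>carrier := A \<one>\<^bsub>G\<^esub>\<rparr>)"
    have "J = {\<zero>\<^bsub>R\<^esub>} \<or> J = carrier R" if J: "ideal J R" for J
    proof -
      have "J \<inter> A \<one>\<^bsub>G\<^esub> = {\<zero>\<^bsub>R\<^esub>} \<or> J \<inter> A \<one>\<^bsub>G\<^esub> = A \<one>\<^bsub>G\<^esub>"
        using gs contraction_ideal[OF sr J] contraction_invariant[OF one equalityD1[OF comm] J]
        unfolding G_simple_ring_def by auto
      then show ?thesis
      proof
        assume "J \<inter> A \<one>\<^bsub>G\<^esub> = {\<zero>\<^bsub>R\<^esub>}"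
        then show ?thesis using nonzero_ideal_meets_component_one[OF assms(2) J] by blast
      next
        assume "J \<inter> A \<one>\<^bsub>G\<^esub> = A \<one>\<^bsub>G\<^esub>"
        then have "\<one>\<^bsub>R\<^esub> \<in> J" using one by blast
        then show ?thesis using ideal.one_imp_carrier[OF J] by blast
      qed
    qed
    then show "simple_ring R" using R.ring_axioms by (simp add: simple_ring_def)
  next
    assume simple: "simple_ring R"
    have "I = {\<zero>\<^bsub>R\<^esub>} \<or> I = A \<one>\<^bsub>G\<^esub>"
      if I: "ideal I (R\<lparr>carrier := A \<one>\<^bsub>G\<^esub>\<rparr>)" and inv: "G_invariant G (canonical_action G R A) I"
      for I
    proof -
      let ?J = "ideal_prod R I (carrier R)"
      interpret I: ideal I "R\<lparr>carrier := A \<one>\<^bsub>G\<^esub>\<rparr>" by fact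
      have IA: "I \<subseteq> A \<one>\<^bsub>G\<^esub>" using I.a_subset by simp
      have zero: "\<zero>\<^bsub>R\<^esub> \<in> I" using additive_subgroup.zero_closed[OF I.is_additive_subgroup] by simp
      have "ideal ?J R"
        using IA equalityD1[OF comm]
        by (intro invariant_ideal_extends[OF one _ zero inv]) (rule subset_trans)
      then consider "?J = {\<zero>\<^bsub>R\<^esub>}" | "?J = carrier R"
        using simple unfolding simple_ring_def by blast
      then show ?thesis
      proof cases
        case 1
        have "x = \<zero>\<^bsub>R\<^esub>" if x: "x \<in> I" for x
        proof -
          have "x \<otimes>\<^bsub>R\<^esub> \<one>\<^bsub>R\<^esub> \<in> ?J" using x by (intro ideal_prod.prod) auto
          moreover have "x \<in> carrier R" using x IA subringE(1)[OF sr] by blast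
          ultimately show ?thesis using 1 by simp
        qed
        then show ?thesis using zero by blast
      next
        case 2
        then have "homogeneous_part \<one>\<^bsub>R\<^esub> \<one>\<^bsub>G\<^esub> \<in> I"
          by (intro homogeneous_part_one_extension[OF I]) simp
        then have "\<one>\<^bsub>R\<^esub> \<in> I"
          by (simp add: homogeneous_part_of_homogeneous one)
        then show ?thesis using I.one_imp_carrier by simp
      qed
    qed
    then show "G_simple_ring G (canonical_action G R A) (R\<lparr>carrier := A \<one>\<^bsub>G\<^esub>\<rparr>)"
      using R.subring_is_ring[OF sr] by (simp add: G_simple_ring_def)
  qed
qed

end
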